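(* Let $R$ be a p.q.-Baer $*$-ring with Conrad's partial order $\leq$. For each $m\in R$, the initial segment $[0,m]=\{a\in R : a\leq m\}$, with the order induced by $\leq$, is an orthomodular poset (with least element $0$ and greatest element $m$) for some orthocomplementation on $[0,m]$ such that, denoting by $\perp_m$ the orthogonality relation on $[0,m]$ defined by this orthocomplementation, the following hold. For all $m\in R$ and all $a,b\in[0,m]$, $a\perp_m b$ if and only if $a\perp b$. Moreover, for all $m,n\in R$, if $a,b\in[0,m]$ satisfy $a\perp_m b$ and $a,b\leq n$, then $a\perp_n b$.
   Context: A $*$-ring is an (associative) ring $R$ with an involution $x\mapsto x^*$, i.e. an additive anti-automorphism with $(x^* )^*=x$. A projection is an element $e\in R$ with $e=e^2=e^*$. A $*$-ring $R$ is a p.q.-Baer $*$-ring if for every $a\in R$ there is a projection $e\in R$ with $r_R(aR)=eR$, where $r_R(B)=\{x\in R : bx=0 \text{ for every } b\in B\}$. (Such a ring automatically has an identity element and is semiprime.) Conrad's partial order on $R$: $a\leq b$ if and only if $arb=ara$ for all $r\in R$; this is a partial order on every p.q.-Baer $*$-ring. For $a,b\in R$, $a\perp b$ means $aRb=0$. A poset $(P,\leq,0,1)$ with least element $0$ and greatest element $1$ is orthocomplemented if there is an operation ${}^{\perp}:P\to P$ (an orthocomplementation) such that for all $a,b\in P$: (i) $a\wedge a^{\perp}$ and $a\vee a^{\perp}$ exist, $a\wedge a^{\perp}=0$ and $a\vee a^{\perp}=1$; (ii) $(a^{\perp})^{\perp}=a$; (iii) if $a\leq b$ then $b^{\perp}\leq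 a^{\perp}$. In an orthocomplemented poset the associated orthogonality relation is: $a$ is orthogonal to $b$ iff $a\leq b^{\perp}$. An orthocomplemented poset is orthomodular if for all $a,b\in P$: (i) if $a$ is orthogonal to $b$, then $a\vee b$ exists; (ii) if $a\leq b$, then there is $c\in P$ with $c\leq a^{\perp}$ and $b=a\vee c$. All joins and meets here are taken in $P$. *)

theory Defs
  imports "HOL-Algebra.Order"
begin

text \<open>
  The class \<open>ring\<close> is that of associative rings, not assumed to be commutative or to have
  an identity element.
\<close>

locale star_ring =
  fixes star :: "'a::ring \<Rightarrow> 'a"
  assumes star_add: "star (x + y) = star x + star y"
    and star_mult: "star (x * y) = star y * star x"
    and star_star: "star (star x) = x"

definition is_projection :: "('a::ring \<Rightarrow> 'a) \<Rightarrow> 'a \<Rightarrow> bool" where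
  "is_projection star e \<longleftrightarrow> e * e = e \<and> star e = e"

definition right_annihilator :: "'a::ring set \<Rightarrow> 'a set" where
  "right_annihilator B = {x. \<forall>b\<in>B. b * x = 0}"

definition right_multiples :: "'a::ring \<Rightarrow> 'a set" where
  "right_multiples a = range (\<lambda>r. a * r)"

locale pq_baer_star_ring = star_ring star for star :: "'a::ring \<Rightarrow> 'a" +
  assumes pq_baer:
    "\<exists>e. is_projection star e \<and> right_annihilator (right_multiples a) = right_multiples e"

definition conrad_le :: "'a::ring \<Rightarrow> 'a \<Rightarrow> bool" where
  "conrad_le a b \<longleftrightarrow> (\<forall>r. a * r * b = a * r * a)"

definition ring_orthogonal :: "'a::ring \<Rightarrow> 'a \<Rightarrow> bool" where
  "ring_orthogonal a b \<longleftrightarrow> (\<forall>r. a * r * b = 0)"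

definition conrad_segment :: "'a::ring \<Rightarrow> 'a gorder" where
  "conrad_segment m = \<lparr>carrier = {a. conrad_le a m}, eq = (=), le = conrad_le\<rparr>"

text \<open>
  All joins and meets below (\<^const>\<open>is_lub\<close>, \<^const>\<open>is_glb\<close>) are taken inside the carrier.
\<close>

locale orthocomplemented_poset = partial_order L for L (structure) +
  fixes zero :: 'a and one :: 'a and oc :: "'a \<Rightarrow> 'a"
  assumes zero_least: "least L zero (carrier L)"
    and one_greatest: "greatest L one (carrier L)"
    and oc_closed: "a \<in> carrier L \<Longrightarrow> oc a \<in> carrier L"
    and meet_oc: "a \<in> carrier L \<Longrightarrow> is_glb L zero {a, oc a}"
    and join_oc: "a \<in> carrier L \<Longrightarrow> is_lub L one {a, oc a}"
    and oc_oc: "a \<in> carrier L \<Longrightarrow> oc (oc a) = a"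
    and oc_antimono: "\<lbrakk>a \<in> carrier L; b \<in> carrier L; a \<sqsubseteq> b\<rbrakk> \<Longrightarrow> oc b \<sqsubseteq> oc a"

definition oc_orthogonal :: "'a gorder \<Rightarrow> ('a \<Rightarrow> 'a) \<Rightarrow> 'a \<Rightarrow> 'a \<Rightarrow> bool" where
  "oc_orthogonal L oc a b \<longleftrightarrow> a \<sqsubseteq>\<^bsub>L\<^esub> oc b"

locale orthomodular_poset = orthocomplemented_poset L zero one oc
  for L :: "'a gorder" (structure) and zero one oc +
  assumes orthogonal_join:
      "\<lbrakk>a \<in> carrier L; b \<in> carrier L; oc_orthogonal L oc a b\<rbrakk> \<Longrightarrow> \<exists>s. is_lub L s {a, b}"
    and orthomodular:
      "\<lbrakk>a \<in> carrier L; b \<in> carrier L; a \<sqsubseteq> b\<rbrakk>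
        \<Longrightarrow> \<exists>c\<in>carrier L. c \<sqsubseteq> oc a \<and> is_lub L b {a, c}"

end

theory Submission
  imports Defs
begin

text \<open>
  The unit and semiprimeness come from the annihilating projections: such a projection \<open>e\<close>
  generates a two-sided ideal, so \<open>r * e = e * r * e\<close>, and applying the involution shows
  that \<open>e\<close> is central. In a semiprime ring \<open>a \<perp> b\<close> is symmetric and additive in each argument,
  and \<open>a \<le> b\<close> just says \<open>a \<perp> b - a\<close>. Hence \<open>a \<mapsto> m - a\<close> is the required orthocomplementation of
  \<open>[0, m]\<close>, and the join of orthogonal elements is their sum.
\<close>

lemma conrad_le_iff: "conrad_le a b \<longleftrightarrow> ring_orthogonal a (b - a)"
  by (simp add: conrad_le_def ring_orthogonal_def right_diff_distrib)

lemma ring_orthogonal_add_left: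
  "ring_orthogonal a c \<Longrightarrow> ring_orthogonal b c \<Longrightarrow> ring_orthogonal (a + b) c"
  by (simp add: ring_orthogonal_def distrib_right)

lemma ring_orthogonal_add_right:
  "ring_orthogonal a b \<Longrightarrow> ring_orthogonal a c \<Longrightarrow> ring_orthogonal a (b + c)"
  by (simp add: ring_orthogonal_def distrib_left)

lemma ring_orthogonal_diff_left:
  "ring_orthogonal a c \<Longrightarrow> ring_orthogonal b c \<Longrightarrow> ring_orthogonal (a - b) c"
  by (simp add: ring_orthogonal_def left_diff_distrib)

lemma ring_orthogonal_diff_right:
  "ring_orthogonal a b \<Longrightarrow> ring_orthogonal a c \<Longrightarrow> ring_orthogonal a (b - c)"
  by (simp add: ring_orthogonal_def right_diff_distrib)

lemma conrad_le_zero: "conrad_le 0 a"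
  by (simp add: conrad_le_def)

lemma conrad_le_refl: "conrad_le a a"
  by (simp add: conrad_le_def)

lemma conrad_segment_simps [simp]:
  "a \<in> carrier (conrad_segment m) \<longleftrightarrow> conrad_le a m"
  "(.=\<^bsub>conrad_segment m\<^esub>) = (=)"
  "a \<sqsubseteq>\<^bsub>conrad_segment m\<^esub> b \<longleftrightarrow> conrad_le a b"
  by (simp_all add: conrad_segment_def)

text \<open>The hypothesis says \<open>a\<close> \<perp> \<open>m - a\<close>, and each of
  \<open>b\<close> and \<open>m - b - a\<close> is \<open>m - a\<close> minus the other, so
  \<open>a\<close> is orthogonal to both or to neither. This links the complement
  \<open>m - b\<close> to an orthogonality that no longer mentions \<open>m\<close>.\<close>

lemma conrad_le_diff_iff:
  assumes "conrad_le a m"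
  shows "conrad_le a (m - b) \<longleftrightarrow> ring_orthogonal a b"
proof -
  have 1: "ring_orthogonal a (m - a)"
    using assms by (simp add: conrad_le_iff)
  have 2: "m - b - a = (m - a) - b" "b = (m - a) - (m - b - a)"
    by simp_all
  show ?thesis
    unfolding conrad_le_iff using ring_orthogonal_diff_right[OF 1] 2 by metis
qed

locale semiprime_ring =
  fixes R :: "'a::ring itself"
  assumes semiprime: "ring_orthogonal a a \<Longrightarrow> a = (0::'a)"
begin

text \<open>Any product of the form \<open>(b * r * a) * s * (b * r * a)\<close> contains the
  vanishing factor \<open>a * s * b\<close>, so semiprimeness kills
  \<open>b * r * a\<close>.\<close>

lemma ring_orthogonal_sym:
  assumes "ring_orthogonal a (b::'a)"
  shows "ring_orthogonal b a"
  unfolding ring_orthogonal_def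
proof
  fix r
  have "b * r * a * s * (b * r * a) = b * r * (a * s * b) * r * a" for s
    by (simp add: mult.assoc)
  then have "ring_orthogonal (b * r * a) (b * r * a)"
    using assms by (simp add: ring_orthogonal_def)
  then show "b * r * a = 0"
    by (rule semiprime)
qed

lemma ring_orthogonal_mono_left:
  fixes a b c :: 'a
  assumes "conrad_le a b" "ring_orthogonal b c"
  shows "ring_orthogonal a c"
  unfolding ring_orthogonal_def
proof
  fix s
  \<comment> \<open>The order allows the second \<open>a\<close> to be replaced by \<open>b\<close>,
    which exposes the zero factor \<open>b * s * c\<close>. Hence \<open>a\<close> \<perp>
    \<open>a * s * c\<close>; symmetry then makes \<open>a * s * c\<close> orthogonal to
    itself.\<close>
  have "a * r * (a * s * c) = a * (r * b * s) * c" for r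
  proof -
    have "a * r * (a * s * c) = (a * r * a) * s * c" by (simp add: mult.assoc)
    also have "\<dots> = (a * r * b) * s * c" using assms(1) by (simp add: conrad_le_def)
    finally show ?thesis by (simp add: mult.assoc)
  qed
  moreover have "a * (r * b * s) * c = a * r * (b * s * c)" for r
    by (simp add: mult.assoc)
  ultimately have "ring_orthogonal a (a * s * c)"
    using assms(2) by (simp add: ring_orthogonal_def)
  then have "ring_orthogonal (a * s * c) a"
    by (rule ring_orthogonal_sym)
  then have "a * s * c * t * (a * s * c) = 0" for t
    using mult.assoc[of "a * s * c * t" a "s * c"]
    by (simp add: ring_orthogonal_def mult.assoc[of a s c])
  then show "a * s * c = 0"
    by (intro semiprime) (simp add: ring_orthogonal_def)
qed

lemma conrad_le_diff: "conrad_le (a::'a) m \<Longrightarrow> conrad_le (m - a) m"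
  by (simp add: conrad_le_iff ring_orthogonal_sym)

lemma conrad_le_antisym:
  assumes "conrad_le a b" "conrad_le b (a::'a)"
  shows "a = b"
proof -
  have "ring_orthogonal a (b - a)" "ring_orthogonal b (a - b)"
    using assms by (simp_all add: conrad_le_iff)
  then have "ring_orthogonal (b - a) (b - a)"
    by (simp add: ring_orthogonal_def left_diff_distrib right_diff_distrib)
  then show ?thesis
    using semiprime by fastforce
qed

text \<open>Split \<open>c - a\<close> as \<open>(c - b) + (b - a)\<close>; \<open>a\<close> \<perp>
  \<open>c - b\<close> is inherited from \<open>b\<close> by monotonicity.\<close>

lemma conrad_le_trans:
  assumes "conrad_le a b" "conrad_le b (c::'a)"
  shows "conrad_le a c"
proof -
  have "ring_orthogonal a (c - b)" "ring_orthogonal a (b - a)"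
    using assms ring_orthogonal_mono_left by (auto simp: conrad_le_iff)
  from ring_orthogonal_add_right[OF this] show ?thesis
    by (simp add: conrad_le_iff)
qed

text \<open>The difference of the two complements is \<open>b - a\<close>, and both \<open>a\<close>
  and \<open>b\<close> are orthogonal to \<open>m - b\<close>.\<close>

lemma conrad_le_diff_antimono:
  assumes "conrad_le a b" "conrad_le b (m::'a)"
  shows "conrad_le (m - b) (m - a)"
proof -
  have "ring_orthogonal b (m - b)" "ring_orthogonal a (m - b)"
    using assms ring_orthogonal_mono_left by (auto simp: conrad_le_iff)
  from ring_orthogonal_diff_left[OF this] show ?thesis
    by (simp add: conrad_le_iff ring_orthogonal_sym)
qed

text \<open>This gives the meet of \<open>a\<close> and its complement: \<open>c\<close> is
  orthogonal to \<open>a\<close> and to \<open>a - c\<close>, hence to their difference, which is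
  \<open>c\<close> itself.\<close>

lemma conrad_le_both_diff:
  assumes "conrad_le c a" "conrad_le c (m - a)" "conrad_le c (m::'a)"
  shows "c = 0"
proof -
  have "ring_orthogonal c a"
    using assms by (simp add: conrad_le_diff_iff)
  moreover have "ring_orthogonal c (a - c)"
    using assms by (simp add: conrad_le_iff)
  ultimately have "ring_orthogonal c (a - (a - c))"
    by (rule ring_orthogonal_diff_right)
  then show ?thesis
    by (simp add: semiprime)
qed

lemma conrad_le_add_left: "ring_orthogonal a b \<Longrightarrow> conrad_le a (a + (b::'a))"
  by (simp add: conrad_le_iff)

lemma conrad_le_add_right: "ring_orthogonal a b \<Longrightarrow> conrad_le b (a + (b::'a))"
  by (simp add: conrad_le_iff ring_orthogonal_sym)

text \<open>The remainder \<open>c - (a + b)\<close> is \<open>c - a\<close> minus \<open>b\<close>,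
  hence orthogonal to \<open>a\<close>; exchanging the roles of \<open>a\<close> and
  \<open>b\<close> handles the other summand.\<close>

lemma conrad_add_le:
  assumes "ring_orthogonal a b" "conrad_le a c" "conrad_le b (c::'a)"
  shows "conrad_le (a + b) c"
proof -
  have "ring_orthogonal a ((c - a) - b)" "ring_orthogonal b ((c - b) - a)"
    using assms by (auto intro: ring_orthogonal_diff_right ring_orthogonal_sym simp: conrad_le_iff)
  then show ?thesis
    unfolding conrad_le_iff
    by (intro ring_orthogonal_add_left) (simp_all add: algebra_simps)
qed

lemma conrad_segment_partial_order: "partial_order (conrad_segment (m::'a))"
proof unfold_locales
qed (auto intro: conrad_le_refl conrad_le_antisym conrad_le_trans)

lemma is_lub_conrad_segment_add:
  assumes "ring_orthogonal a b" "conrad_le a m" "conrad_le b (m::'a)"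
  shows "is_lub (conrad_segment m) (a + b) {a, b}"
  using assms
  by (auto simp: least_def Upper_def
      intro: conrad_add_le conrad_le_add_left conrad_le_add_right)

lemma conrad_segment_orthomodular:
  "orthomodular_poset (conrad_segment (m::'a)) 0 m (\<lambda>a. m - a)"
proof -
  interpret partial_order "conrad_segment m"
    by (rule conrad_segment_partial_order)
  show ?thesis
  proof
    show "least (conrad_segment m) 0 (carrier (conrad_segment m))"
      by (auto simp: least_def conrad_le_zero)
    show "greatest (conrad_segment m) m (carrier (conrad_segment m))"
      by (auto simp: greatest_def conrad_le_refl)
  next
    fix a assume "a \<in> carrier (conrad_segment m)"
    then have a: "conrad_le a m" by simp
    show "m - a \<in> carrier (conrad_segment m)"
      using a by (simp add: conrad_le_diff)
    have "conrad_le c 0" if "conrad_le c a" "conrad_le c (m - a)" "conrad_le c m" for c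
      using conrad_le_both_diff[OF that] conrad_le_refl by simp
    then show "is_glb (conrad_segment m) 0 {a, m - a}"
      using a conrad_le_diff[OF a]
      by (auto simp: greatest_def Lower_def conrad_le_zero)
    have "ring_orthogonal a (m - a)"
      using a by (simp add: conrad_le_iff)
    from is_lub_conrad_segment_add[OF this a conrad_le_diff[OF a]]
    show "is_lub (conrad_segment m) m {a, m - a}" by simp
    show "m - (m - a) = a" by simp
  next
    fix a b
    assume "a \<in> carrier (conrad_segment m)" "b \<in> carrier (conrad_segment m)"
      and "a \<sqsubseteq>\<^bsub>conrad_segment m\<^esub> b"
    then have a: "conrad_le a m" and b: "conrad_le b m" and ab: "conrad_le a b"
      by simp_all
    show "m - b \<sqsubseteq>\<^bsub>conrad_segment m\<^esub> m - a"
      using ab b by (simp add: conrad_le_diff_antimono)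
    \<comment> \<open>The orthomodular law is witnessed by \<open>b - a\<close>: it lies below
      \<open>b\<close>, hence below \<open>m\<close>, and being orthogonal to \<open>a\<close> it
      lies below \<open>m - a\<close> and has join \<open>a + (b - a) = b\<close> with
      \<open>a\<close>.\<close>
    have c: "conrad_le (b - a) m"
      using ab b conrad_le_diff conrad_le_trans by blast
    have orth: "ring_orthogonal a (b - a)"
      using ab by (simp add: conrad_le_iff)
    have "conrad_le (b - a) (m - a)"
      using c orth by (simp add: conrad_le_diff_iff ring_orthogonal_sym)
    then show "\<exists>c\<in>carrier (conrad_segment m).
        c \<sqsubseteq>\<^bsub>conrad_segment m\<^esub> m - a \<and> is_lub (conrad_segment m) b {a, c}"
      using is_lub_conrad_segment_add[OF orth a c] c by (intro bexI[of _ "b - a"]) simp_all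
  next
    fix a b
    assume "a \<in> carrier (conrad_segment m)" "b \<in> carrier (conrad_segment m)"
      and "oc_orthogonal (conrad_segment m) (\<lambda>a. m - a) a b"
    then show "\<exists>s. is_lub (conrad_segment m) s {a, b}"
      using is_lub_conrad_segment_add
      by (auto simp: oc_orthogonal_def conrad_le_diff_iff)
  qed
qed

end

context pq_baer_star_ring
begin

text \<open>The right annihilator of zero is the whole ring, so its projection \<open>u\<close> is a
  left identity; the involution turns it into a right identity.\<close>

lemma unit_exists: "\<exists>u::'a. \<forall>x. u * x = x \<and> x * u = x"
proof -
  obtain u where u: "is_projection star u"
    and "right_annihilator (right_multiples 0) = right_multiples u"
    using pq_baer by blast
  then have "UNIV = right_multiples u"
    by (simp add: right_annihilator_def right_multiples_def)
  then have "\<exists>r. x = u * r" for x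
    unfolding right_multiples_def by blast
  then have left: "u * x = x" for x
    using u unfolding is_projection_def by (metis mult.assoc)
  have "x * u = x" for x
    using left[of "star x"] u star_mult star_star unfolding is_projection_def by metis
  with left show ?thesis by blast
qed

sublocale semiprime_ring "TYPE('a)"
proof
  fix a :: 'a
  assume aa: "ring_orthogonal a a"
  obtain u where u: "\<And>x::'a. u * x = x" "\<And>x::'a. x * u = x"
    using unit_exists by blast
  obtain e where e: "e * e = e" "star e = e"
    and "right_annihilator (right_multiples a) = right_multiples e"
    using pq_baer unfolding is_projection_def by blast
  then have ann: "(\<forall>r. a * r * x = 0) \<longleftrightarrow> (\<exists>r. x = e * r)" for x
    unfolding right_annihilator_def right_multiples_def by blast
  have fixed: "e * x = x" if "\<forall>r. a * r * x = 0" for x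
    using that ann e(1) by (metis mult.assoc)
  have ae: "a * r * e = 0" for r
    using ann e(1) by metis
  \<comment> \<open>The annihilator of \<open>a R\<close> also absorbs multiplication from the left,
    so it contains \<open>x * e\<close>, which \<open>e\<close> therefore fixes.\<close>
  have "a * r * (x * e) = 0" for r x
    using ae[of "r * x"] by (simp add: mult.assoc)
  then have ideal: "e * (x * e) = x * e" for x
    using fixed by blast
  \<comment> \<open>Apply the involution to the previous identity at \<open>star x\<close> to get
    its mirror image; both sides then equal \<open>e * x * e\<close>.\<close>
  have "star (e * (star x * e)) = star (star x * e)" for x
    by (simp only: ideal)
  then have "e * x * e = e * x" for x
    by (simp add: star_mult star_star e mult.assoc)
  then have central: "e * x = x * e" for x
    using ideal by (metis mult.assoc)
  have "a = e * a"
    using aa fixed by (simp add: ring_orthogonal_def)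
  \<comment> \<open>The unit is inserted because \<open>e\<close> annihilates products
    \<open>a * r\<close>, so \<open>a\<close> must be written as \<open>a * u\<close>.\<close>
  also have "\<dots> = a * u * e"
    by (simp add: central u)
  finally show "a = 0"
    by (simp add: ae)
qed

end

theorem theorem4p8:
  fixes star :: "'a::ring \<Rightarrow> 'a"
  assumes "pq_baer_star_ring star"
  shows "\<exists>oc :: 'a \<Rightarrow> 'a \<Rightarrow> 'a.
    (\<forall>m. orthomodular_poset (conrad_segment m) 0 m (oc m)) \<and>
    (\<forall>m. \<forall>a\<in>carrier (conrad_segment m). \<forall>b\<in>carrier (conrad_segment m).
       oc_orthogonal (conrad_segment m) (oc m) a b \<longleftrightarrow> ring_orthogonal a b) \<and>
    (\<forall>m n. \<forall>a\<in>carrier (conrad_segment m). \<forall>b\<in>carrier (conrad_segment m).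
       oc_orthogonal (conrad_segment m) (oc m) a b \<and> conrad_le a n \<and> conrad_le b n \<longrightarrow>
       oc_orthogonal (conrad_segment n) (oc n) a b)"
proof -
  interpret pq_baer_star_ring star by fact
  show ?thesis
    \<comment> \<open>With this choice, orthogonality in every segment is ring orthogonality, so it
      carries over from \<open>m\<close> to \<open>n\<close>.\<close>
    by (intro exI[of _ "\<lambda>m a. m - a"])
      (simp add: conrad_segment_orthomodular oc_orthogonal_def conrad_le_diff_iff)
qed

end
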